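(* Let $\Phi$ be a commutative associative unital ring, let $R$ be a commutative associative unital $\Phi$-algebra, let $\mathfrak m$ be a maximal ideal of $R$, and let $L_R$ be the Lorentz type algebra over $R$. Then $L_R$ is $\mathfrak m$-simple if and only if $R$ is $\mathfrak m$-$2$-formally real. In particular, for a field $K$, the Lorentz type algebra $L_K$ is simple if and only if $K$ is $2$-formally real (equivalently, if and only if $K$ contains no square root of $-1$).
   Context: For a commutative unital ring $R$, the Lorentz type algebra $L_R$ is the Lie $R$-algebra which is free as an $R$-module with basis $b_1,\dots,b_6$ and whose (alternating) bracket is given by $[b_1,b_2]=b_4$, $[b_1,b_3]=b_5$, $[b_1,b_4]=b_2$, $[b_1,b_5]=b_3$, $[b_1,b_6]=0$, $[b_2,b_3]=b_6$, $[b_2,b_4]=-b_1$, $[b_2,b_5]=0$, $[b_2,b_6]=b_3$, $[b_3,b_4]=0$, $[b_3,b_5]=-b_1$, $[b_3,b_6]=-b_2$, $[b_4,b_5]=-b_6$, $[b_4,b_6]=b_5$, $[b_5,b_6]=-b_4$. (For $R=\mathbb R$ this is $\mathfrak o(1,3)$.) Let $\mathfrak m$ be a maximal ideal of $R$, $K:=R/\mathfrak m$, and $\phi\colon L_R\to L_R\otimes_R K=L_K$ the canonical epimorphism, with kernel $\mathfrak m L_R$. An ideal $I$ of $L_R$ is $\mathfrak m$-null if $\phi(I)=0$ (i.e. $I\subset\mathfrak m L_R$) and $\mathfrak m$-total if $\phi(I)=L_K$. $L_R$ is $\mathfrak m$-simple if every ideal of $L_R$ is $\mathfrak m$-null or $\mathfrak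 m$-total. A field $K$ is $2$-formally real if for all $x,y\in K$, $x^2+y^2=0$ implies $x=y=0$. For an ideal $\mathfrak i$ of a ring $R$, $R$ is $\mathfrak i$-$2$-formally real if for all $x,y\in R$, $x^2+y^2\in\mathfrak i$ implies $x,y\in\mathfrak i$. *)

theory Defs
  imports "HOL-Algebra.Module" "HOL-Algebra.QuotRing"
begin

text \<open>
  As with \<^type>\<open>module\<close>, where only the additive part of the underlying ring record matters, the
  fields \<open>mult\<close> and \<open>one\<close> of a Lie algebra carry no meaning; the Lie bracket is a separate field.
\<close>

record ('a, 'b) lie_alg = "('a, 'b) module" +
  bracket :: "['b, 'b] \<Rightarrow> 'b"

text \<open>Since Lie brackets are alternating, ideals need to be closed on one side only.\<close>

definition lie_ideal ::
    "('a, 'm) ring_scheme \<Rightarrow> ('a, 'b, 'n) lie_alg_scheme \<Rightarrow> 'b set \<Rightarrow> bool" where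
  "lie_ideal R L I \<longleftrightarrow> submodule I R L \<and> (\<forall>x\<in>carrier L. \<forall>y\<in>I. bracket L x y \<in> I)"

definition simple_lie_alg ::
    "('a, 'm) ring_scheme \<Rightarrow> ('a, 'b, 'n) lie_alg_scheme \<Rightarrow> bool" where
  "simple_lie_alg R L \<longleftrightarrow>
     (\<exists>x\<in>carrier L. \<exists>y\<in>carrier L. bracket L x y \<noteq> \<zero>\<^bsub>L\<^esub>) \<and>
     (\<forall>I. lie_ideal R L I \<longrightarrow> I = {\<zero>\<^bsub>L\<^esub>} \<or> I = carrier L)"

text \<open>
  An entry \<open>((i, j), (s, k))\<close> means \<open>[b\<^sub>i, b\<^sub>j] = s b\<^sub>k\<close>. Pairs \<open>i < j\<close> that are not listed
  have bracket 0.
\<close>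

definition lorentz_table :: "nat \<times> nat \<Rightarrow> (int \<times> nat) option" where
  "lorentz_table = map_of
     [((1, 2), (1, 4)), ((1, 3), (1, 5)), ((1, 4), (1, 2)), ((1, 5), (1, 3)),
      ((2, 3), (1, 6)), ((2, 4), (-1, 1)), ((2, 6), (1, 3)),
      ((3, 5), (-1, 1)), ((3, 6), (-1, 2)),
      ((4, 5), (-1, 6)), ((4, 6), (1, 5)),
      ((5, 6), (-1, 4))]"

text \<open>The coefficient of \<open>b\<^sub>k\<close> in \<open>[b\<^sub>i, b\<^sub>j]\<close>, for arbitrary \<open>i\<close> and \<open>j\<close>.\<close>

definition lorentz_coeff :: "nat \<Rightarrow> nat \<Rightarrow> nat \<Rightarrow> int" where
  "lorentz_coeff i j k =
     (case lorentz_table (i, j) of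
        Some (s, l) \<Rightarrow> if l = k then s else 0
      | None \<Rightarrow>
          (case lorentz_table (j, i) of
             Some (s, l) \<Rightarrow> if l = k then - s else 0
           | None \<Rightarrow> 0))"

text \<open>
  The free module of rank 6 is realised by coordinate functions on \<open>{1..6}\<close>, where \<open>x\<close> stands for
  \<open>x 1 b\<^sub>1 + \<dots> + x 6 b\<^sub>6\<close>. The bracket is the bilinear extension of the table.
\<close>

definition lorentz :: "('a, 'm) ring_scheme \<Rightarrow> ('a, nat \<Rightarrow> 'a) lie_alg" where
  "lorentz R =
     \<lparr>carrier = {1..6} \<rightarrow>\<^sub>E carrier R,
      mult = undefined,
      one = undefined,
      zero = (\<lambda>k\<in>{1..6}. \<zero>\<^bsub>R\<^esub>),
      add = (\<lambda>x y. \<lambda>k\<in>{1..6}. x k \<oplus>\<^bsub>R\<^esub> y k),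
      smult = (\<lambda>r x. \<lambda>k\<in>{1..6}. r \<otimes>\<^bsub>R\<^esub> x k),
      bracket = (\<lambda>x y. \<lambda>k\<in>{1..6}.
        \<Oplus>\<^bsub>R\<^esub>i\<in>{1..6}. \<Oplus>\<^bsub>R\<^esub>j\<in>{1..6}. [lorentz_coeff i j k] \<cdot>\<^bsub>R\<^esub> (x i \<otimes>\<^bsub>R\<^esub> y j))\<rparr>"

text \<open>
  The canonical epimorphism from \<open>L\<^sub>R\<close> onto \<open>L\<^sub>R \<otimes> R/\<mm>\<close>, the latter identified with the Lorentz
  type algebra over \<open>R/\<mm>\<close>, reduces coordinates modulo \<open>\<mm>\<close>.
\<close>

definition lorentz_red :: "('a, 'm) ring_scheme \<Rightarrow> 'a set \<Rightarrow> (nat \<Rightarrow> 'a) \<Rightarrow> nat \<Rightarrow> 'a set" where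
  "lorentz_red R m x = (\<lambda>k\<in>{1..6}. m +>\<^bsub>R\<^esub> x k)"

definition lorentz_null :: "('a, 'm) ring_scheme \<Rightarrow> 'a set \<Rightarrow> (nat \<Rightarrow> 'a) set \<Rightarrow> bool" where
  "lorentz_null R m I \<longleftrightarrow> lorentz_red R m ` I = {\<zero>\<^bsub>lorentz (R Quot m)\<^esub>}"

definition lorentz_total :: "('a, 'm) ring_scheme \<Rightarrow> 'a set \<Rightarrow> (nat \<Rightarrow> 'a) set \<Rightarrow> bool" where
  "lorentz_total R m I \<longleftrightarrow> lorentz_red R m ` I = carrier (lorentz (R Quot m))"

definition lorentz_simple_at :: "('a, 'm) ring_scheme \<Rightarrow> 'a set \<Rightarrow> bool" where
  "lorentz_simple_at R m \<longleftrightarrow>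
     (\<forall>I. lie_ideal R (lorentz R) I \<longrightarrow> lorentz_null R m I \<or> lorentz_total R m I)"

definition two_formally_real :: "('a, 'm) ring_scheme \<Rightarrow> bool" where
  "two_formally_real K \<longleftrightarrow>
     (\<forall>x\<in>carrier K. \<forall>y\<in>carrier K.
        x [^]\<^bsub>K\<^esub> (2::nat) \<oplus>\<^bsub>K\<^esub> y [^]\<^bsub>K\<^esub> (2::nat) = \<zero>\<^bsub>K\<^esub> \<longrightarrow> x = \<zero>\<^bsub>K\<^esub> \<and> y = \<zero>\<^bsub>K\<^esub>)"

definition two_formally_real_mod :: "('a, 'm) ring_scheme \<Rightarrow> 'a set \<Rightarrow> bool" where
  "two_formally_real_mod R J \<longleftrightarrow>
     (\<forall>x\<in>carrier R. \<forall>y\<in>carrier R.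
        x [^]\<^bsub>R\<^esub> (2::nat) \<oplus>\<^bsub>R\<^esub> y [^]\<^bsub>R\<^esub> (2::nat) \<in> J \<longrightarrow> x \<in> J \<and> y \<in> J)"

end

theory Submission
  imports Defs
begin

text \<open>
  The basis splits into the pairs \<open>(b\<^sub>1, b\<^sub>6)\<close>, \<open>(b\<^sub>2, b\<^sub>5)\<close>, \<open>(b\<^sub>3, b\<^sub>4)\<close>, and the map \<open>J\<close> given by
  \<open>b\<^sub>1 \<mapsto> b\<^sub>6 \<mapsto> -b\<^sub>1\<close>, \<open>b\<^sub>5 \<mapsto> b\<^sub>2 \<mapsto> -b\<^sub>5\<close>, \<open>b\<^sub>3 \<mapsto> b\<^sub>4 \<mapsto> -b\<^sub>3\<close> commutes with the adjoint
  representation and satisfies \<open>J\<^sup>2 = -1\<close>. If \<open>i\<^sup>2 = -1\<close>, the eigenspace of \<open>J\<close> for \<open>i\<close> is a proper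
  nonzero ideal. Conversely, \<open>1 - (ad b\<^sub>k)\<^sup>2\<close> for \<open>k = 1, 2, 3\<close> projects onto the span of the pair
  that contains \<open>b\<^sub>k\<close>, so that a nonzero ideal contains some \<open>u b\<^sub>2 + v b\<^sub>5\<close> with \<open>(u, v) \<noteq> (0, 0)\<close>, hence
  \<open>(u\<^sup>2 + v\<^sup>2) b\<^sub>3\<close>, and \<open>b\<^sub>3\<close> generates everything over a 2-formally real field.
  Images and preimages of ideals under reduction modulo \<open>\<mm>\<close> carry the result over to \<open>L\<^sub>R\<close>.
\<close>

section \<open>Six coordinates in place of functions on \<open>{1..6}\<close>\<close>

declare One_nat_def [simp del]

text \<open>Starting from the constantly \<open>undefined\<close> function makes the vector
  extensional, as membership in \<open>{1..6} \<rightarrow>\<^sub>E carrier R\<close> demands.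
  Operations on the free module thus become rewriting of six explicit entries.\<close>

definition lvec :: "'a \<Rightarrow> 'a \<Rightarrow> 'a \<Rightarrow> 'a \<Rightarrow> 'a \<Rightarrow> 'a \<Rightarrow> nat \<Rightarrow> 'a" where
  "lvec a b c d e f = (\<lambda>_. undefined)(1 := a, 2 := b, 3 := c, 4 := d, 5 := e, 6 := f)"

lemma atLeastAtMost_1_6: "{1..6::nat} = {1, 2, 3, 4, 5, 6}" by auto

lemma restrict_eq_lvec: "(\<lambda>k\<in>{1..6}. g k) = lvec (g 1) (g 2) (g 3) (g 4) (g 5) (g 6)"
  by (auto simp: lvec_def fun_eq_iff atLeastAtMost_1_6)

text \<open>The first equation can rewrite only while the index \<open>1\<close> is not turned into
  \<open>Suc 0\<close>, hence the removal of \<open>One_nat_def\<close> from the simplifier.\<close>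

lemma lvec_apply:
  "lvec a b c d e f 1 = a" "lvec a b c d e f 2 = b" "lvec a b c d e f 3 = c"
  "lvec a b c d e f 4 = d" "lvec a b c d e f 5 = e" "lvec a b c d e f 6 = f"
  by (simp_all add: lvec_def)

lemma lvec_eq_iff [simp]:
  "lvec a b c d e f = lvec a' b' c' d' e' f' \<longleftrightarrow>
     a = a' \<and> b = b' \<and> c = c' \<and> d = d' \<and> e = e' \<and> f = f'"
  by (metis lvec_apply)

lemma lvec_in_carrier_iff [simp]:
  "lvec a b c d e f \<in> carrier (lorentz R) \<longleftrightarrow>
     a \<in> carrier R \<and> b \<in> carrier R \<and> c \<in> carrier R \<and>
     d \<in> carrier R \<and> e \<in> carrier R \<and> f \<in> carrier R"
proof -
  have "lvec a b c d e f \<in> extensional {1..6}"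
    by (auto simp: extensional_def lvec_def)
  then show ?thesis
    by (simp add: lorentz_def PiE_iff atLeastAtMost_1_6 lvec_apply)
qed

text \<open>An extensional function is determined by its values on \<open>{1..6}\<close>. This
  elimination turns claims about arbitrary elements into coordinate identities.\<close>

lemma lorentz_carrierE:
  assumes "x \<in> carrier (lorentz R)"
  obtains a b c d e f where "a \<in> carrier R" "b \<in> carrier R" "c \<in> carrier R"
    "d \<in> carrier R" "e \<in> carrier R" "f \<in> carrier R" "x = lvec a b c d e f"
proof -
  have "x \<in> {1..6} \<rightarrow>\<^sub>E carrier R"
    using assms by (simp add: lorentz_def)
  then have "x = (\<lambda>k\<in>{1..6}. x k)" and "\<forall>k\<in>{1..6}. x k \<in> carrier R"
    by (auto simp: PiE_restrict)
  then show ?thesis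
    using that[of "x 1" "x 2" "x 3" "x 4" "x 5" "x 6"] restrict_eq_lvec[of x] by simp
qed

lemma lorentz_zero [simp]:
  "\<zero>\<^bsub>lorentz R\<^esub> = lvec \<zero>\<^bsub>R\<^esub> \<zero>\<^bsub>R\<^esub> \<zero>\<^bsub>R\<^esub> \<zero>\<^bsub>R\<^esub> \<zero>\<^bsub>R\<^esub> \<zero>\<^bsub>R\<^esub>"
  unfolding lorentz_def by (simp add: restrict_eq_lvec)

lemma lorentz_add [simp]:
  "lvec a b c d e f \<oplus>\<^bsub>lorentz R\<^esub> lvec a' b' c' d' e' f' =
     lvec (a \<oplus>\<^bsub>R\<^esub> a') (b \<oplus>\<^bsub>R\<^esub> b') (c \<oplus>\<^bsub>R\<^esub> c') (d \<oplus>\<^bsub>R\<^esub> d') (e \<oplus>\<^bsub>R\<^esub> e') (f \<oplus>\<^bsub>R\<^esub> f')"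
  by (simp add: lorentz_def restrict_eq_lvec lvec_apply)

lemma lorentz_smult [simp]:
  "r \<odot>\<^bsub>lorentz R\<^esub> lvec a b c d e f =
     lvec (r \<otimes>\<^bsub>R\<^esub> a) (r \<otimes>\<^bsub>R\<^esub> b) (r \<otimes>\<^bsub>R\<^esub> c) (r \<otimes>\<^bsub>R\<^esub> d) (r \<otimes>\<^bsub>R\<^esub> e) (r \<otimes>\<^bsub>R\<^esub> f)"
  by (simp add: lorentz_def restrict_eq_lvec lvec_apply)

lemma lorentz_red_lvec [simp]:
  "lorentz_red R m (lvec a b c d e f) =
     lvec (m +>\<^bsub>R\<^esub> a) (m +>\<^bsub>R\<^esub> b) (m +>\<^bsub>R\<^esub> c) (m +>\<^bsub>R\<^esub> d) (m +>\<^bsub>R\<^esub> e) (m +>\<^bsub>R\<^esub> f)"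
  by (simp add: lorentz_red_def restrict_eq_lvec lvec_apply)

section \<open>Explicit bracket and module structure over a commutative ring\<close>

context cring
begin

lemma finsum_1_6:
  assumes "\<And>i. i \<in> {1..6::nat} \<Longrightarrow> g i \<in> carrier R"
  shows "(\<Oplus>i\<in>{1..6}. g i) = g 1 \<oplus> (g 2 \<oplus> (g 3 \<oplus> (g 4 \<oplus> (g 5 \<oplus> g 6))))"
  using assms unfolding atLeastAtMost_1_6 by simp

text \<open>The structure constants are only -1, 0 and 1; this rule and the next evaluate the
  multiples by -1 and 0.\<close>

lemma add_pow_int_minus_one: "x \<in> carrier R \<Longrightarrow> [(- 1 :: int)] \<cdot> x = \<ominus> x"
  using add.int_pow_neg[of x 1] by (simp add: a_inv_def)

lemma add_pow_int_zero: "[(0 :: int)] \<cdot> x = \<zero>"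
  by (simp add: add_pow_def)

text \<open>Each \<open>b\<^sub>k\<close> is, up to sign, the bracket of exactly two of the listed
  pairs, so four of the 36 terms survive in each coordinate.\<close>

lemma lorentz_bracket:
  assumes [simp]: "a \<in> carrier R" "b \<in> carrier R" "c \<in> carrier R"
    "d \<in> carrier R" "e \<in> carrier R" "f \<in> carrier R"
    and [simp]: "a' \<in> carrier R" "b' \<in> carrier R" "c' \<in> carrier R"
    "d' \<in> carrier R" "e' \<in> carrier R" "f' \<in> carrier R"
  shows "bracket (lorentz R) (lvec a b c d e f) (lvec a' b' c' d' e' f') =
    lvec (d \<otimes> b' \<ominus> b \<otimes> d' \<oplus> e \<otimes> c' \<ominus> c \<otimes> e')
         (a \<otimes> d' \<ominus> d \<otimes> a' \<oplus> f \<otimes> c' \<ominus> c \<otimes> f')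
         (a \<otimes> e' \<ominus> e \<otimes> a' \<oplus> b \<otimes> f' \<ominus> f \<otimes> b')
         (a \<otimes> b' \<ominus> b \<otimes> a' \<oplus> f \<otimes> e' \<ominus> e \<otimes> f')
         (a \<otimes> c' \<ominus> c \<otimes> a' \<oplus> d \<otimes> f' \<ominus> f \<otimes> d')
         (b \<otimes> c' \<ominus> c \<otimes> b' \<oplus> e \<otimes> d' \<ominus> d \<otimes> e')"
proof -
  define x y where "x = lvec a b c d e f" and "y = lvec a' b' c' d' e' f'"
  have x [simp]: "x 1 = a" "x 2 = b" "x 3 = c" "x 4 = d" "x 5 = e" "x 6 = f"
   and y [simp]: "y 1 = a'" "y 2 = b'" "y 3 = c'" "y 4 = d'" "y 5 = e'" "y 6 = f'"
    by (simp_all only: lvec_apply x_def y_def)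
  \<comment> \<open>\<open>G\<close> and \<open>H\<close> keep the double sum folded while it is
    expanded for a generic \<open>k\<close>; the table is evaluated only at the end, when all
    indices are numerals.\<close>
  define G where "G k i j = [lorentz_coeff i j k] \<cdot> (x i \<otimes> y j)" for k i j
  define H where "H k i = G k i 1 \<oplus> (G k i 2 \<oplus> (G k i 3 \<oplus> (G k i 4 \<oplus> (G k i 5 \<oplus> G k i 6))))" for k i
  have G: "G k i j \<in> carrier R" if "i \<in> {1..6}" "j \<in> {1..6}" for i j k
    using that unfolding atLeastAtMost_1_6 G_def by auto
  have inner: "(\<Oplus>j\<in>{1..6}. G k i j) = H k i" if "i \<in> {1..6}" for i k
    unfolding H_def by (intro finsum_1_6 G that)
  have H: "H k i \<in> carrier R" if "i \<in> {1..6}" for i k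
    using that by (simp add: H_def G)
  have *: "(\<Oplus>i\<in>{1..6}. \<Oplus>j\<in>{1..6}. G k i j) = H k 1 \<oplus> (H k 2 \<oplus> (H k 3 \<oplus> (H k 4 \<oplus> (H k 5 \<oplus> H k 6))))" for k
  proof -
    have "(\<Oplus>i\<in>{1..6}. \<Oplus>j\<in>{1..6}. G k i j) = finsum R (H k) {1..6}"
      using H inner by (intro finsum_cong') auto
    also have "\<dots> = H k 1 \<oplus> (H k 2 \<oplus> (H k 3 \<oplus> (H k 4 \<oplus> (H k 5 \<oplus> H k 6))))"
      by (intro finsum_1_6 H)
    finally show ?thesis .
  qed
  show ?thesis
    unfolding x_def[symmetric] y_def[symmetric]
    unfolding lorentz_def lie_alg.simps G_def[symmetric] * restrict_eq_lvec lvec_eq_iff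
    unfolding H_def G_def x y
    by (intro conjI; simp add: lorentz_coeff_def lorentz_table_def
        add_pow_int_minus_one add_pow_int_zero a_minus_def a_ac)
qed

lemma lorentz_bracket_closed:
  assumes "x \<in> carrier (lorentz R)" "y \<in> carrier (lorentz R)"
  shows "bracket (lorentz R) x y \<in> carrier (lorentz R)"
  using assms by (elim lorentz_carrierE) (simp add: lorentz_bracket)

text \<open>The adjoint actions of \<open>b\<^sub>1\<close>, \<open>b\<^sub>2\<close>,
  \<open>b\<^sub>3\<close> and \<open>b\<^sub>6\<close> suffice for all the generation arguments
  below.\<close>

lemma lorentz_bracket_basis:
  assumes "a \<in> carrier R" "b \<in> carrier R" "c \<in> carrier R"
    "d \<in> carrier R" "e \<in> carrier R" "f \<in> carrier R"
  shows "bracket (lorentz R) (lvec \<one> \<zero> \<zero> \<zero> \<zero> \<zero>) (lvec a b c d e f) = lvec \<zero> d e b c \<zero>"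
    and "bracket (lorentz R) (lvec \<zero> \<one> \<zero> \<zero> \<zero> \<zero>) (lvec a b c d e f) = lvec (\<ominus> d) \<zero> f (\<ominus> a) \<zero> c"
    and "bracket (lorentz R) (lvec \<zero> \<zero> \<one> \<zero> \<zero> \<zero>) (lvec a b c d e f) = lvec (\<ominus> e) (\<ominus> f) \<zero> \<zero> (\<ominus> a) (\<ominus> b)"
    and "bracket (lorentz R) (lvec \<zero> \<zero> \<zero> \<zero> \<zero> \<one>) (lvec a b c d e f) = lvec \<zero> c (\<ominus> b) e (\<ominus> d) \<zero>"
  using assms by (simp_all add: lorentz_bracket a_minus_def)

lemma abelian_group_lorentz: "abelian_group (lorentz R)"
proof (rule abelian_groupI)
  fix x assume "x \<in> carrier (lorentz R)"
  then obtain a b c d e f where x: "x = lvec a b c d e f" and [simp]: "a \<in> carrier R" "b \<in> carrier R" "c \<in> carrier R"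
    "d \<in> carrier R" "e \<in> carrier R" "f \<in> carrier R"
    by (rule lorentz_carrierE)
  show "\<exists>y\<in>carrier (lorentz R). y \<oplus>\<^bsub>lorentz R\<^esub> x = \<zero>\<^bsub>lorentz R\<^esub>"
    by (rule bexI[of _ "lvec (\<ominus> a) (\<ominus> b) (\<ominus> c) (\<ominus> d) (\<ominus> e) (\<ominus> f)"]) (simp_all add: x l_neg)
qed (auto elim!: lorentz_carrierE simp: a_ac)

lemma module_lorentz: "module R (lorentz R)"
  by (rule moduleI[OF is_cring abelian_group_lorentz])
    (auto elim!: lorentz_carrierE simp: l_distr r_distr m_assoc)

end

section \<open>Ideals as sets closed under the operations\<close>

text \<open>Closure under negation comes for free from scalar multiplication by -1, which leaves
  only conditions that are easy to check in coordinates.\<close>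

lemma lie_ideal_iff:
  fixes R :: "('a, 'm) ring_scheme" and M :: "('a, 'b, 'n) lie_alg_scheme"
  assumes "module R M"
  shows "lie_ideal R M I \<longleftrightarrow>
     I \<subseteq> carrier M \<and> \<zero>\<^bsub>M\<^esub> \<in> I \<and> (\<forall>x\<in>I. \<forall>y\<in>I. x \<oplus>\<^bsub>M\<^esub> y \<in> I) \<and>
     (\<forall>r\<in>carrier R. \<forall>x\<in>I. r \<odot>\<^bsub>M\<^esub> x \<in> I) \<and> (\<forall>x\<in>carrier M. \<forall>y\<in>I. bracket M x y \<in> I)"
    (is "_ \<longleftrightarrow> ?P")
proof -
  interpret module R M by fact
  show ?thesis
  proof
    assume "lie_ideal R M I"
    then have sub: "submodule I R M" and br: "\<forall>x\<in>carrier M. \<forall>y\<in>I. bracket M x y \<in> I"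
      by (auto simp: lie_ideal_def)
    have "\<zero>\<^bsub>M\<^esub> \<in> I"
      using subgroup.one_closed[OF submodule.axioms(1)[OF sub]] by simp
    then show ?P
      using br submoduleE(1,4,5)[OF sub] by auto
  next
    assume P: ?P
    have "\<ominus>\<^bsub>M\<^esub> x \<in> I" if "x \<in> I" for x
    proof -
      have "x \<in> carrier M"
        using P that by blast
      then have "\<ominus>\<^bsub>M\<^esub> x = (\<ominus>\<^bsub>R\<^esub> \<one>\<^bsub>R\<^esub>) \<odot>\<^bsub>M\<^esub> x"
        by (simp add: smult_l_minus)
      then show ?thesis
        using P that by simp
    qed
    then show "lie_ideal R M I"
      using P unfolding lie_ideal_def by (auto intro!: submoduleI)
  qed
qed

section \<open>A proper ideal from a square root of -1, and generation by
  \<open>b\<^sub>3\<close>\<close>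

context cring
begin

lemmas lorentz_ideal_iff = lie_ideal_iff[OF module_lorentz]

text \<open>The set is the eigenspace of \<open>J\<close> for \<open>i\<close>: solving
  \<open>J x = i x\<close> leaves \<open>d\<close>, \<open>e\<close>, \<open>f\<close> free and
  determines the first three coordinates. It is stable under brackets because \<open>J\<close>
  commutes with the adjoint representation; the proof verifies this in coordinates.\<close>

lemma lorentz_sqrt_ideal:
  assumes [simp]: "i \<in> carrier R" and i: "i \<otimes> i = \<ominus> \<one>"
  shows "lie_ideal R (lorentz R)
    {lvec (i \<otimes> f) (\<ominus> (i \<otimes> e)) (i \<otimes> d) d e f | d e f. d \<in> carrier R \<and> e \<in> carrier R \<and> f \<in> carrier R}"
    (is "lie_ideal R _ ?I")
proof -
  have mem: "lvec a b c d e f \<in> ?I \<longleftrightarrow> d \<in> carrier R \<and> e \<in> carrier R \<and> f \<in> carrier R \<and>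
      a = i \<otimes> f \<and> b = \<ominus> (i \<otimes> e) \<and> c = i \<otimes> d" for a b c d e f
    by auto
  \<comment> \<open>Once products are reordered, \<open>i \<otimes> i\<close> occurs only nested in
    longer products, where the assumption \<open>i\<close> alone does not match.\<close>
  have ii: "i \<otimes> (i \<otimes> z) = \<ominus> z" if "z \<in> carrier R" for z
    using that by (simp add: m_assoc[symmetric] i l_minus)
  have "bracket (lorentz R) x y \<in> ?I" if x: "x \<in> carrier (lorentz R)" and y: "y \<in> ?I" for x y
  proof -
    obtain a b c d e f where x: "x = lvec a b c d e f" and [simp]: "a \<in> carrier R" "b \<in> carrier R" "c \<in> carrier R"
      "d \<in> carrier R" "e \<in> carrier R" "f \<in> carrier R"
      using x by (rule lorentz_carrierE)
    obtain d' e' f' where y: "y = lvec (i \<otimes> f') (\<ominus> (i \<otimes> e')) (i \<otimes> d') d' e' f'"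
      and [simp]: "d' \<in> carrier R" "e' \<in> carrier R" "f' \<in> carrier R"
      using y by auto
    show ?thesis
      unfolding x y by (subst lorentz_bracket; (subst mem)?)
        (simp_all add: a_minus_def l_distr r_distr l_minus r_minus minus_add m_ac a_ac i ii)
  qed
  moreover have "x \<oplus>\<^bsub>lorentz R\<^esub> y \<in> ?I" if "x \<in> ?I" "y \<in> ?I" for x y
    using that by (clarsimp simp: mem r_distr minus_add)
  moreover have "r \<odot>\<^bsub>lorentz R\<^esub> x \<in> ?I" if "r \<in> carrier R" "x \<in> ?I" for r x
    using that by (clarsimp simp: mem r_minus m_lcomm)
  moreover have "\<zero>\<^bsub>lorentz R\<^esub> \<in> ?I"
    by (simp add: mem)
  moreover have "?I \<subseteq> carrier (lorentz R)"
    by auto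
  ultimately show ?thesis
    unfolding lorentz_ideal_iff by (intro conjI ballI)
qed

text \<open>Brackets lead from \<open>b\<^sub>3\<close> to \<open>b\<^sub>5\<close> and
  \<open>b\<^sub>6\<close>, from these to \<open>-b\<^sub>1\<close> and \<open>-b\<^sub>2\<close>,
  and from the latter to \<open>-b\<^sub>4\<close>. All coefficients are units, so no division is
  involved.\<close>

lemma lorentz_ideal_eq_carrierI:
  assumes I: "lie_ideal R (lorentz R) I" and b3: "lvec \<zero> \<zero> \<one> \<zero> \<zero> \<zero> \<in> I"
  shows "I = carrier (lorentz R)"
proof -
  have add: "x \<oplus>\<^bsub>lorentz R\<^esub> y \<in> I" if "x \<in> I" "y \<in> I" for x y
    using I that by (simp add: lorentz_ideal_iff)
  have smult: "r \<odot>\<^bsub>lorentz R\<^esub> x \<in> I" if "r \<in> carrier R" "x \<in> I" for r x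
    using I that by (simp add: lorentz_ideal_iff)
  have br: "bracket (lorentz R) x y \<in> I" if "x \<in> carrier (lorentz R)" "y \<in> I" for x y
    using I that by (simp add: lorentz_ideal_iff)
  have b5: "lvec \<zero> \<zero> \<zero> \<zero> \<one> \<zero> \<in> I"
    using br[OF _ b3, of "lvec \<one> \<zero> \<zero> \<zero> \<zero> \<zero>"] by (simp add: lorentz_bracket_basis)
  have b6: "lvec \<zero> \<zero> \<zero> \<zero> \<zero> \<one> \<in> I"
    using br[OF _ b3, of "lvec \<zero> \<one> \<zero> \<zero> \<zero> \<zero>"] by (simp add: lorentz_bracket_basis)
  have b1: "lvec (\<ominus> \<one>) \<zero> \<zero> \<zero> \<zero> \<zero> \<in> I"
    using br[OF _ b5, of "lvec \<zero> \<zero> \<one> \<zero> \<zero> \<zero>"] by (simp add: lorentz_bracket_basis)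
  have b2: "lvec \<zero> (\<ominus> \<one>) \<zero> \<zero> \<zero> \<zero> \<in> I"
    using br[OF _ b6, of "lvec \<zero> \<zero> \<one> \<zero> \<zero> \<zero>"] by (simp add: lorentz_bracket_basis)
  have b4: "lvec \<zero> \<zero> \<zero> (\<ominus> \<one>) \<zero> \<zero> \<in> I"
    using br[OF _ b2, of "lvec \<one> \<zero> \<zero> \<zero> \<zero> \<zero>"] by (simp add: lorentz_bracket_basis)
  have "x \<in> I" if "x \<in> carrier (lorentz R)" for x
    using that
  proof (rule lorentz_carrierE)
    fix a b c d e f
    assume [simp]: "a \<in> carrier R" "b \<in> carrier R" "c \<in> carrier R"
      "d \<in> carrier R" "e \<in> carrier R" "f \<in> carrier R" and x: "x = lvec a b c d e f"
    \<comment> \<open>The scalars at \<open>b\<^sub>1\<close>, \<open>b\<^sub>2\<close>,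
      \<open>b\<^sub>4\<close> are negated because these vectors were reached with a minus
      sign.\<close>
    have "(\<ominus> a) \<odot>\<^bsub>lorentz R\<^esub> lvec (\<ominus> \<one>) \<zero> \<zero> \<zero> \<zero> \<zero> \<oplus>\<^bsub>lorentz R\<^esub>
      ((\<ominus> b) \<odot>\<^bsub>lorentz R\<^esub> lvec \<zero> (\<ominus> \<one>) \<zero> \<zero> \<zero> \<zero> \<oplus>\<^bsub>lorentz R\<^esub>
      (c \<odot>\<^bsub>lorentz R\<^esub> lvec \<zero> \<zero> \<one> \<zero> \<zero> \<zero> \<oplus>\<^bsub>lorentz R\<^esub>
      ((\<ominus> d) \<odot>\<^bsub>lorentz R\<^esub> lvec \<zero> \<zero> \<zero> (\<ominus> \<one>) \<zero> \<zero> \<oplus>\<^bsub>lorentz R\<^esub>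
      (e \<odot>\<^bsub>lorentz R\<^esub> lvec \<zero> \<zero> \<zero> \<zero> \<one> \<zero> \<oplus>\<^bsub>lorentz R\<^esub>
      f \<odot>\<^bsub>lorentz R\<^esub> lvec \<zero> \<zero> \<zero> \<zero> \<zero> \<one>)))) \<in> I" (is "?s \<in> I")
      by (intro add smult b1 b2 b3 b4 b5 b6) simp_all
    moreover have "?s = x"
      by (simp add: x l_minus r_minus)
    ultimately show "x \<in> I"
      by simp
  qed
  then show ?thesis
    using I by (auto simp: lorentz_ideal_iff)
qed

end

section \<open>Simplicity over a field\<close>

context field
begin

lemma two_formally_real_imp_lorentz_ideal_trivial:
  assumes real: "two_formally_real R" and I: "lie_ideal R (lorentz R) I" and "I \<noteq> {\<zero>\<^bsub>lorentz R\<^esub>}"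
  shows "I = carrier (lorentz R)"
proof -
  have sub: "I \<subseteq> carrier (lorentz R)" and zero: "\<zero>\<^bsub>lorentz R\<^esub> \<in> I"
    using I by (simp_all only: lorentz_ideal_iff)
  have add: "x \<oplus>\<^bsub>lorentz R\<^esub> y \<in> I" if "x \<in> I" "y \<in> I" for x y
    using I that by (simp add: lorentz_ideal_iff)
  have smult: "r \<odot>\<^bsub>lorentz R\<^esub> x \<in> I" if "r \<in> carrier R" "x \<in> I" for r x
    using I that by (simp add: lorentz_ideal_iff)
  have br: "bracket (lorentz R) x y \<in> I" if "x \<in> carrier (lorentz R)" "y \<in> I" for x y
    using I that by (simp add: lorentz_ideal_iff)
  have ad:
    "lvec \<zero> d e b c \<zero> \<in> I" "lvec (\<ominus> d) \<zero> f (\<ominus> a) \<zero> c \<in> I"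
    "lvec (\<ominus> e) (\<ominus> f) \<zero> \<zero> (\<ominus> a) (\<ominus> b) \<in> I" "lvec \<zero> c (\<ominus> b) e (\<ominus> d) \<zero> \<in> I"
    if "lvec a b c d e f \<in> I" for a b c d e f
  proof -
    have "lvec a b c d e f \<in> carrier (lorentz R)"
      using sub that by blast
    then show
      "lvec \<zero> d e b c \<zero> \<in> I" "lvec (\<ominus> d) \<zero> f (\<ominus> a) \<zero> c \<in> I"
      "lvec (\<ominus> e) (\<ominus> f) \<zero> \<zero> (\<ominus> a) (\<ominus> b) \<in> I" "lvec \<zero> c (\<ominus> b) e (\<ominus> d) \<zero> \<in> I"
      using br[OF _ that, of "lvec \<one> \<zero> \<zero> \<zero> \<zero> \<zero>"] br[OF _ that, of "lvec \<zero> \<one> \<zero> \<zero> \<zero> \<zero>"]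
        br[OF _ that, of "lvec \<zero> \<zero> \<one> \<zero> \<zero> \<zero>"] br[OF _ that, of "lvec \<zero> \<zero> \<zero> \<zero> \<zero> \<one>"]
      by (simp_all add: lorentz_bracket_basis)
  qed
  have total: ?thesis if be: "lvec \<zero> b \<zero> \<zero> e \<zero> \<in> I" "b \<noteq> \<zero> \<or> e \<noteq> \<zero>" for b e
  proof -
    have [simp]: "b \<in> carrier R" "e \<in> carrier R"
      using be(1) sub by auto
    have "b [^] (2::nat) \<oplus> e [^] (2::nat) \<noteq> \<zero>"
      using real be(2) unfolding two_formally_real_def by (metis \<open>b \<in> carrier R\<close> \<open>e \<in> carrier R\<close>)
    then have n: "e \<otimes> e \<oplus> b \<otimes> b \<noteq> \<zero>"
      by (simp add: numeral_2_eq_2 a_comm)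
    \<comment> \<open>Bracketing with \<open>b\<^sub>1\<close> gives
      \<open>(e + b J) b\<^sub>3\<close>, and with \<open>b\<^sub>6\<close> gives \<open>J\<close>
      of that vector. The combination multiplies by the conjugate \<open>e - b J\<close>, which
      cancels \<open>b\<^sub>4\<close> and leaves the sum of squares at
      \<open>b\<^sub>3\<close>.\<close>
    have "e \<odot>\<^bsub>lorentz R\<^esub> lvec \<zero> \<zero> e b \<zero> \<zero> \<oplus>\<^bsub>lorentz R\<^esub> (\<ominus> b) \<odot>\<^bsub>lorentz R\<^esub> lvec \<zero> \<zero> (\<ominus> b) e \<zero> \<zero> \<in> I"
      using ad(1)[OF be(1)] ad(4)[OF be(1)] by (intro add smult) simp_all
    then have "lvec \<zero> \<zero> (e \<otimes> e \<oplus> b \<otimes> b) \<zero> \<zero> \<zero> \<in> I"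
      by (simp add: l_minus r_minus m_comm r_neg)
    from smult[OF _ this, of "inv (e \<otimes> e \<oplus> b \<otimes> b)"]
    have "lvec \<zero> \<zero> \<one> \<zero> \<zero> \<zero> \<in> I"
      using n by (simp add: field_Units)
    then show ?thesis
      by (rule lorentz_ideal_eq_carrierI[OF I])
  qed
  obtain x where "x \<in> I" "x \<noteq> \<zero>\<^bsub>lorentz R\<^esub>"
    using zero assms(3) by blast
  moreover from this sub have "x \<in> carrier (lorentz R)"
    by blast
  then obtain a b c d e f where [simp]: "a \<in> carrier R" "b \<in> carrier R" "c \<in> carrier R"
      "d \<in> carrier R" "e \<in> carrier R" "f \<in> carrier R" and "x = lvec a b c d e f"
    by (rule lorentz_carrierE)
  ultimately have x: "lvec a b c d e f \<in> I" and nz: "a \<noteq> \<zero> \<or> b \<noteq> \<zero> \<or> c \<noteq> \<zero> \<or> d \<noteq> \<zero> \<or> e \<noteq> \<zero> \<or> f \<noteq> \<zero>"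
    by auto
  \<comment> \<open>With \<open>y\<close> the result of applying \<open>ad b\<^sub>k\<close> twice
    to the chosen vector, this is the projection onto one of the three pairs.\<close>
  have diff: "lvec a b c d e f \<oplus>\<^bsub>lorentz R\<^esub> (\<ominus> \<one>) \<odot>\<^bsub>lorentz R\<^esub> y \<in> I" if "y \<in> I" for y
    using that by (intro add smult x) simp_all
  have af: "lvec a \<zero> \<zero> \<zero> \<zero> f \<in> I"
    using diff[OF ad(1)[OF ad(1)[OF x]]] by (simp add: l_minus r_neg)
  have be: "lvec \<zero> b \<zero> \<zero> e \<zero> \<in> I"
    using diff[OF ad(2)[OF ad(2)[OF x]]] by (simp add: l_minus r_neg)
  have cd: "lvec \<zero> \<zero> c d \<zero> \<zero> \<in> I"
    using diff[OF ad(3)[OF ad(3)[OF x]]] by (simp add: l_minus r_neg)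
  \<comment> \<open>\<open>ad b\<^sub>3\<close> carries the pair \<open>b\<^sub>1, b\<^sub>6\<close>
    to \<open>b\<^sub>2, b\<^sub>5\<close>, and \<open>ad b\<^sub>1\<close> does so for
    \<open>b\<^sub>3, b\<^sub>4\<close>, both injectively. Whichever coordinate is nonzero,
    \<open>total\<close> therefore applies.\<close>
  have "lvec \<zero> (\<ominus> f) \<zero> \<zero> (\<ominus> a) \<zero> \<in> I" "lvec \<zero> d \<zero> \<zero> c \<zero> \<in> I"
    using ad(3)[OF af] ad(1)[OF cd] by simp_all
  with be nz show ?thesis
    using total by (metis \<open>a \<in> carrier R\<close> \<open>f \<in> carrier R\<close> minus_minus minus_zero)
qed

text \<open>A root of -1 and \<open>\<one>\<close> have squares summing to zero. Conversely, if the
  squares of \<open>x\<close> and \<open>y\<close> sum to zero and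
  \<open>y \<noteq> \<zero>\<close>, then \<open>x \<otimes> inv y\<close> is a root of -1; if
  \<open>y = \<zero>\<close>, then \<open>x\<close> vanishes since a field has no zero
  divisors.\<close>

lemma two_formally_real_iff_no_sqrt:
  "two_formally_real R \<longleftrightarrow> \<not> (\<exists>x\<in>carrier R. x [^] (2::nat) = \<ominus> \<one>)"
proof
  assume real: "two_formally_real R"
  show "\<not> (\<exists>x\<in>carrier R. x [^] (2::nat) = \<ominus> \<one>)"
  proof
    assume "\<exists>x\<in>carrier R. x [^] (2::nat) = \<ominus> \<one>"
    then obtain x where "x \<in> carrier R" "x [^] (2::nat) \<oplus> \<one> [^] (2::nat) = \<zero>"
      by (auto simp: l_neg)
    then show False
      using real unfolding two_formally_real_def by (metis one_closed one_not_zero)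
  qed
next
  assume no: "\<not> (\<exists>x\<in>carrier R. x [^] (2::nat) = \<ominus> \<one>)"
  show "two_formally_real R"
    unfolding two_formally_real_def
  proof (intro ballI impI)
    fix x y
    assume [simp]: "x \<in> carrier R" "y \<in> carrier R" and eq: "x [^] (2::nat) \<oplus> y [^] (2::nat) = \<zero>"
    have y: "y = \<zero>"
    proof (rule ccontr)
      assume "y \<noteq> \<zero>"
      then have [simp]: "inv y \<in> carrier R" and yy: "y \<otimes> inv y = \<one>"
        by (simp_all add: field_Units)
      have "x [^] (2::nat) = \<ominus> (y [^] (2::nat))"
        using eq by (simp add: minus_equality[symmetric] a_comm)
      then have "(x \<otimes> inv y) [^] (2::nat) = \<ominus> ((y \<otimes> inv y) [^] (2::nat))"
        by (simp add: nat_pow_distrib l_minus del: nat_pow_Suc)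
      then show False
        using no yy by auto
    qed
    then show "x = \<zero> \<and> y = \<zero>"
      using eq by (simp add: numeral_2_eq_2 integral_iff)
  qed
qed

text \<open>Kept apart from \<open>simple_lie_alg\<close> because simplicity at an ideal translates
  into exactly this condition on the quotient.\<close>

lemma lorentz_ideals_trivial_iff:
  "(\<forall>I. lie_ideal R (lorentz R) I \<longrightarrow> I = {\<zero>\<^bsub>lorentz R\<^esub>} \<or> I = carrier (lorentz R)) \<longleftrightarrow>
     two_formally_real R"
proof
  assume triv: "\<forall>I. lie_ideal R (lorentz R) I \<longrightarrow> I = {\<zero>\<^bsub>lorentz R\<^esub>} \<or> I = carrier (lorentz R)"
  show "two_formally_real R"
    unfolding two_formally_real_iff_no_sqrt
  proof
    assume "\<exists>i\<in>carrier R. i [^] (2::nat) = \<ominus> \<one>"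
    then obtain i where i: "i \<in> carrier R" "i \<otimes> i = \<ominus> \<one>"
      by (auto simp: numeral_2_eq_2)
    define I where "I = {lvec (i \<otimes> f) (\<ominus> (i \<otimes> e)) (i \<otimes> d) d e f | d e f.
      d \<in> carrier R \<and> e \<in> carrier R \<and> f \<in> carrier R}"
    have "I = {\<zero>\<^bsub>lorentz R\<^esub>} \<or> I = carrier (lorentz R)"
      using triv lorentz_sqrt_ideal[OF i] unfolding I_def by blast
    \<comment> \<open>The choice \<open>f = \<one>\<close> shows that the eigenspace is nonzero. It
      misses \<open>b\<^sub>1\<close>, since \<open>f = \<zero>\<close> forces the first coordinate
      to vanish.\<close>
    moreover have "lvec i \<zero> \<zero> \<zero> \<zero> \<one> \<in> I"
      using i by (auto simp: I_def)
    moreover have "lvec \<one> \<zero> \<zero> \<zero> \<zero> \<zero> \<notin> I"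
      using i by (auto simp: I_def)
    ultimately show False
      by auto
  qed
qed (use two_formally_real_imp_lorentz_ideal_trivial in metis)

lemma simple_lorentz_iff: "simple_lie_alg R (lorentz R) \<longleftrightarrow> two_formally_real R"
proof -
  \<comment> \<open>\<open>[b\<^sub>1, b\<^sub>2] = b\<^sub>4\<close> shows that the algebra is not
    abelian over any field.\<close>
  have "bracket (lorentz R) (lvec \<one> \<zero> \<zero> \<zero> \<zero> \<zero>) (lvec \<zero> \<one> \<zero> \<zero> \<zero> \<zero>) \<noteq> \<zero>\<^bsub>lorentz R\<^esub>"
    by (simp add: lorentz_bracket_basis)
  moreover have "lvec \<one> \<zero> \<zero> \<zero> \<zero> \<zero> \<in> carrier (lorentz R)" "lvec \<zero> \<one> \<zero> \<zero> \<zero> \<zero> \<in> carrier (lorentz R)"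
    by simp_all
  ultimately show ?thesis
    unfolding simple_lie_alg_def lorentz_ideals_trivial_iff by blast
qed

end

section \<open>Reduction modulo an ideal\<close>

text \<open>Reduction is a surjective Lie homomorphism, semilinear along the projection of scalars.
  The images of ideals are therefore exactly the ideals downstairs, and null and total mean that the
  image is zero or everything.\<close>

lemma lorentz_simple_at_iff_quotient:
  assumes "cring R" and "ideal m R"
  shows "lorentz_simple_at R m \<longleftrightarrow>
    (\<forall>J. lie_ideal (R Quot m) (lorentz (R Quot m)) J \<longrightarrow>
       J = {\<zero>\<^bsub>lorentz (R Quot m)\<^esub>} \<or> J = carrier (lorentz (R Quot m)))"
proof -
  interpret R: cring R by fact
  interpret ideal m R by fact
  define Q where "Q = R Quot m"
  interpret Q: cring Q
    unfolding Q_def using assms(1) by (rule quotient_is_cring)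
  interpret h: ring_hom_ring R Q "(+>\<^bsub>R\<^esub>) m"
    unfolding Q_def by (rule rcos_ring_hom_ring)
  let ?L = "lorentz R" and ?M = "lorentz Q" and ?h = "(+>\<^bsub>R\<^esub>) m" and ?red = "lorentz_red R m"
  have surj: "carrier Q = ?h ` carrier R"
    unfolding Q_def FactRing_def A_RCOSETS_def' by auto
  have red_closed: "?red x \<in> carrier ?M" if "x \<in> carrier ?L" for x
    using that by (elim lorentz_carrierE) simp
  have red_zero: "?red \<zero>\<^bsub>?L\<^esub> = \<zero>\<^bsub>?M\<^esub>"
    using h.hom_zero by simp
  have red_add: "?red (x \<oplus>\<^bsub>?L\<^esub> y) = ?red x \<oplus>\<^bsub>?M\<^esub> ?red y"
    if "x \<in> carrier ?L" "y \<in> carrier ?L" for x y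
    using that by (elim lorentz_carrierE) simp
  have red_smult: "?red (r \<odot>\<^bsub>?L\<^esub> x) = ?h r \<odot>\<^bsub>?M\<^esub> ?red x"
    if "r \<in> carrier R" "x \<in> carrier ?L" for r x
    using that by (elim lorentz_carrierE) simp
  have red_bracket: "?red (bracket ?L x y) = bracket ?M (?red x) (?red y)"
    if "x \<in> carrier ?L" "y \<in> carrier ?L" for x y
    using that
    by (elim lorentz_carrierE) (simp add: R.lorentz_bracket Q.lorentz_bracket a_minus_def)
  have red_surj: "\<exists>x\<in>carrier ?L. ?red x = y" if "y \<in> carrier ?M" for y
    using that
  proof (rule lorentz_carrierE)
    fix a b c d e f
    assume "a \<in> carrier Q" "b \<in> carrier Q" "c \<in> carrier Q"
      "d \<in> carrier Q" "e \<in> carrier Q" "f \<in> carrier Q" and y: "y = lvec a b c d e f"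
    then obtain a' b' c' d' e' f' where "a' \<in> carrier R" "b' \<in> carrier R" "c' \<in> carrier R"
      "d' \<in> carrier R" "e' \<in> carrier R" "f' \<in> carrier R"
      and "a = ?h a'" "b = ?h b'" "c = ?h c'" "d = ?h d'" "e = ?h e'" "f = ?h f'"
      unfolding surj by blast
    then show ?thesis
      by (intro bexI[of _ "lvec a' b' c' d' e' f'"]) (simp_all add: y)
  qed
  \<comment> \<open>Scalars and outer bracket arguments downstairs have to be lifted first, which is
    where \<open>surj\<close> and \<open>red_surj\<close> enter.\<close>
  have image: "lie_ideal Q ?M (?red ` I)" if "lie_ideal R ?L I" for I
  proof -
    have I: "I \<subseteq> carrier ?L" "\<zero>\<^bsub>?L\<^esub> \<in> I" "\<And>x y. x \<in> I \<Longrightarrow> y \<in> I \<Longrightarrow> x \<oplus>\<^bsub>?L\<^esub> y \<in> I"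
      "\<And>r x. r \<in> carrier R \<Longrightarrow> x \<in> I \<Longrightarrow> r \<odot>\<^bsub>?L\<^esub> x \<in> I"
      "\<And>x y. x \<in> carrier ?L \<Longrightarrow> y \<in> I \<Longrightarrow> bracket ?L x y \<in> I"
      using that by (simp_all only: R.lorentz_ideal_iff)
    show ?thesis
      unfolding Q.lorentz_ideal_iff
    proof (intro conjI ballI)
      show "?red ` I \<subseteq> carrier ?M"
        using I(1) red_closed by auto
      show "\<zero>\<^bsub>?M\<^esub> \<in> ?red ` I"
        using I(2) red_zero by (metis imageI)
      fix x y assume "x \<in> ?red ` I" "y \<in> ?red ` I"
      then show "x \<oplus>\<^bsub>?M\<^esub> y \<in> ?red ` I"
        using I(1,3) by (auto simp: subset_iff simp flip: red_add)
    next
      fix r x assume "r \<in> carrier Q" "x \<in> ?red ` I"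
      then show "r \<odot>\<^bsub>?M\<^esub> x \<in> ?red ` I"
        using I(1,4) by (auto simp: subset_iff surj simp flip: red_smult)
    next
      fix x y assume "x \<in> carrier ?M" "y \<in> ?red ` I"
      then show "bracket ?M x y \<in> ?red ` I"
        using I(1,5) red_surj[of x] by (auto simp: subset_iff simp flip: red_bracket)
    qed
  qed
  have vimage: "lie_ideal R ?L {x \<in> carrier ?L. ?red x \<in> J}"
    and image_vimage: "?red ` {x \<in> carrier ?L. ?red x \<in> J} = J" if "lie_ideal Q ?M J" for J
  proof -
    have J: "J \<subseteq> carrier ?M" "\<zero>\<^bsub>?M\<^esub> \<in> J" "\<And>x y. x \<in> J \<Longrightarrow> y \<in> J \<Longrightarrow> x \<oplus>\<^bsub>?M\<^esub> y \<in> J"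
      "\<And>r x. r \<in> carrier Q \<Longrightarrow> x \<in> J \<Longrightarrow> r \<odot>\<^bsub>?M\<^esub> x \<in> J"
      "\<And>x y. x \<in> carrier ?M \<Longrightarrow> y \<in> J \<Longrightarrow> bracket ?M x y \<in> J"
      using that by (simp_all only: Q.lorentz_ideal_iff)
    interpret L: module R ?L by (rule R.module_lorentz)
    show "lie_ideal R ?L {x \<in> carrier ?L. ?red x \<in> J}"
      unfolding R.lorentz_ideal_iff using J
      \<comment> \<open>The zero vector stays folded so that \<open>red_zero\<close> and the closure
        of \<open>J\<close> can match it.\<close>
      by (auto simp: red_zero red_add red_smult red_bracket red_closed R.lorentz_bracket_closed
          simp del: lorentz_zero)
    show "?red ` {x \<in> carrier ?L. ?red x \<in> J} = J"
      using J(1) red_surj by (auto simp: image_iff subset_iff)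
  qed
  have "?red ` I = {\<zero>\<^bsub>?M\<^esub>} \<or> ?red ` I = carrier ?M"
    if "\<forall>J. lie_ideal Q ?M J \<longrightarrow> J = {\<zero>\<^bsub>?M\<^esub>} \<or> J = carrier ?M" "lie_ideal R ?L I" for I
    using spec[OF that(1)] image[OF that(2)] by (rule mp)
  moreover have "J = {\<zero>\<^bsub>?M\<^esub>} \<or> J = carrier ?M"
    if "\<forall>I. lie_ideal R ?L I \<longrightarrow> ?red ` I = {\<zero>\<^bsub>?M\<^esub>} \<or> ?red ` I = carrier ?M" "lie_ideal Q ?M J" for J
    using spec[OF that(1), of "{x \<in> carrier ?L. ?red x \<in> J}"] vimage[OF that(2)]
    unfolding image_vimage[OF that(2)] by (rule mp)
  ultimately show ?thesis
    unfolding lorentz_simple_at_def lorentz_null_def lorentz_total_def Q_def[symmetric]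
    by (intro iffI allI impI)
qed

text \<open>The projection is a surjective ring homomorphism whose kernel is \<open>I\<close>, so it
  carries sums of squares to sums of squares and turns vanishing into membership in
  \<open>I\<close>.\<close>

lemma (in ideal) two_formally_real_quotient_iff:
  "two_formally_real (R Quot I) \<longleftrightarrow> two_formally_real_mod R I"
proof -
  interpret h: ring_hom_ring R "R Quot I" "(+>) I"
    by (rule rcos_ring_hom_ring)
  have surj: "carrier (R Quot I) = (+>) I ` carrier R"
    unfolding FactRing_def A_RCOSETS_def' by auto
  have zero: "I +> x = \<zero>\<^bsub>R Quot I\<^esub> \<longleftrightarrow> x \<in> I" if "x \<in> carrier R" for x
    using a_rcos_self[OF that] a_rcos_zero[OF ideal_axioms, of x] unfolding FactRing_def ring_record_simps
    by (intro iffI) simp_all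
  have "(I +> x) [^]\<^bsub>R Quot I\<^esub> (2::nat) \<oplus>\<^bsub>R Quot I\<^esub> (I +> y) [^]\<^bsub>R Quot I\<^esub> (2::nat) =
      \<zero>\<^bsub>R Quot I\<^esub> \<longleftrightarrow> x [^] (2::nat) \<oplus> y [^] (2::nat) \<in> I" if "x \<in> carrier R" "y \<in> carrier R" for x y
    using that by (simp add: numeral_2_eq_2 flip: zero)
  then show ?thesis
    unfolding two_formally_real_def two_formally_real_mod_def surj by (simp add: zero)
qed

theorem theorem3:
  fixes \<Phi> :: "('p, 'q) ring_scheme"
    and R :: "('p, 'a, 'r) module_scheme"
    and m :: "'a set"
    and K :: "('k, 's) ring_scheme"
  shows "(cring \<Phi> \<and> algebra \<Phi> R \<and> maximalideal m R \<longrightarrow>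
            (lorentz_simple_at R m \<longleftrightarrow> two_formally_real_mod R m)) \<and>
         (field K \<longrightarrow>
            (simple_lie_alg K (lorentz K) \<longleftrightarrow> two_formally_real K) \<and>
            (simple_lie_alg K (lorentz K) \<longleftrightarrow>
               \<not> (\<exists>x\<in>carrier K. x [^]\<^bsub>K\<^esub> (2::nat) = \<ominus>\<^bsub>K\<^esub> \<one>\<^bsub>K\<^esub>)))"
proof (intro conjI impI)
  assume "cring \<Phi> \<and> algebra \<Phi> R \<and> maximalideal m R"
  then have R: "cring R" and m: "maximalideal m R"
    by (auto dest: algebra.axioms)
  have ideal: "ideal m R"
    using m by (rule maximalideal.axioms)
  \<comment> \<open>Maximality makes the residue ring a field, so the field criterion applies to the
    quotient and pulls back to \<open>R\<close>.\<close>
  have "field (R Quot m)"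
    using m R by (rule maximalideal.quotient_is_field)
  then show "lorentz_simple_at R m \<longleftrightarrow> two_formally_real_mod R m"
    by (simp only: lorentz_simple_at_iff_quotient[OF R ideal] field.lorentz_ideals_trivial_iff
        ideal.two_formally_real_quotient_iff[OF ideal])
qed (simp_all only: field.simple_lorentz_iff field.two_formally_real_iff_no_sqrt)

end
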